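(* Let $P$ be a ca-program. A set of atoms $M$ is a stable model of $P$ (in the sense of ca-programs) if and only if $M$ is a stable model of the mca-program with constraints $e_{\mathit{mca}}(P)$ (in the sense of mca-programs).
   Context: Let $\mathit{At}$ be a set of propositional atoms. Ca-programs. - A cardinality atom (c-atom) is an expression $kXl$ with $X \subseteq \mathit{At}$ finite and integers $0 \leq k \leq l \leq |X|$. - $M \models kXl$ iff $k \leq |M \cap X| \leq l$. - A ca-clause $r$ is $A \leftarrow B_1, \ldots, B_n$ with c-atoms $A$ (the head) and $B_i$ (the body). - A ca-program is a set of ca-clauses. - $M$ satisfies $r$ if $M \models A$ whenever $M \models B_i$ for all $i$; $M \models P$ if it satisfies all clauses. NSS stable models. The NSS-reduct $P^M$ is obtained by: 1. deleting every clause with some body c-atom not satisfied by $M$; 2. replacing each remaining clause $kXl \leftarrow k_1Y_1l_1, \ldots, k_nY_nl_n$ by all clauses $1\{a\} \leftarrow k_1Y_1, \ldots, k_nY_n$ for $a \in X \cap M$. This is a Horn mca-program in which every head is $1\{a\}$. Its least model $\mathit{lm}(P^M)$ is the least set $N$ such that, for every clause, $N \models$ all body mc-atoms implies $a \in N$. $M$ is a stable model of the ca-program $P$ if $M = \mathit{lm}(P^M)$ and $M \models P$. Mca-programs: syntax and satisfaction. - An mc-atom is an expression $kX$ with $X \subseteq \mathit{At}$ finite and $k$ a non-negative integer, with $\mathit{aset}(kX) = X$. - $M \models kX$ iff $|M \cap X| \geq k$, and $M \models \mathbf{not}(kX)$ iff $|M \cap X| < k$. - An mca-clause $r$ is $H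 \leftarrow L_1, \ldots, L_m$ with mc-atom head $\mathit{hd}(r)$, mc-literal body $\mathit{bd}(r)$ (literals $A$ or $\mathbf{not}(A)$), and $\mathit{hset}(r) = \mathit{aset}(\mathit{hd}(r))$. - A constraint mca-clause is $\leftarrow L_1, \ldots, L_m$. $M$ satisfies it iff some $L_i$ is not satisfied by $M$. - $\mathit{hset}(Q) = \bigcup_{r \in Q} \mathit{hset}(r)$. Mca-programs: semantics. - $Q(M) = \{r \in Q : M \models \mathit{bd}(r)\}$. - $T^{\mathit{nd}}_Q(M)$ is the set of all $M'$ with $M' \subseteq \mathit{hset}(Q(M))$ and $M' \models \mathit{hd}(r)$ for all $r \in Q(M)$. - For Horn $Q$ (no $\mathbf{not}$ in bodies), a $Q$-computation is a sequence $(X_n)_{n \geq 0}$ with $X_0 = \emptyset$, $X_n \subseteq X_{n+1}$ and $X_{n+1} \in T^{\mathit{nd}}_Q(X_n)$; a derivable model is the union of a $Q$-computation. - For a (non-constraint) mca-program $Q$, the reduct $Q^M$ removes each clause whose body contains $\mathbf{not}(A)$ with $M \models A$ and deletes all $\mathbf{not}(A)$ literals from the remaining clauses; $M$ is a stable model of $Q$ if $M$ is a derivable model of $Q^M$. - For an mca-program $Q$ possibly containing constraint clauses, $M$ is a stable model of $Q$ if $M$ is a stable model of the set of non-constraint clauses of $Q$ and $M$ satisfies every constraint clause of $Q$. Translation. For a ca-clause $r = kXl \leftarrow k_1X_1l_1, \ldots, k_mX_ml_m$, let - $e^1_{\mathit{mca}}(r)$ be $kX \leftarrow k_1X_1, \ldots,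 k_mX_m, \mathbf{not}((l_1+1)X_1), \ldots, \mathbf{not}((l_m+1)X_m)$; - $e^2_{\mathit{mca}}(r)$ be the constraint $\leftarrow (l+1)X, k_1X_1, \ldots, k_mX_m, \mathbf{not}((l_1+1)X_1), \ldots, \mathbf{not}((l_m+1)X_m)$; - $e_{\mathit{mca}}(P) = \bigcup_{r \in P} \{e^1_{\mathit{mca}}(r), e^2_{\mathit{mca}}(r)\}$. Here expressions $(l+1)X$ with $l+1 > |X|$ are permitted, with the same satisfaction condition; thus they are satisfied by no set. *)

theory Defs
  imports Main
begin

(* The set At of atoms is the universe of the type variable 'a.
   CAtom k X l is the c-atom kXl, MCAtom k X is the mc-atom kX. *)

datatype 'a catom = CAtom nat "'a set" nat

datatype 'a ca_clause = CAClause (ca_hd: "'a catom") (ca_bd: "'a catom list")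

fun wf_catom :: "'a catom \<Rightarrow> bool" where
  "wf_catom (CAtom k X l) \<longleftrightarrow> finite X \<and> k \<le> l \<and> l \<le> card X"

definition ca_program :: "'a ca_clause set \<Rightarrow> bool" where
  "ca_program P \<longleftrightarrow> (\<forall>r\<in>P. wf_catom (ca_hd r) \<and> (\<forall>B\<in>set (ca_bd r). wf_catom B))"

fun ca_sat :: "'a set \<Rightarrow> 'a catom \<Rightarrow> bool" where
  "ca_sat M (CAtom k X l) \<longleftrightarrow> k \<le> card (M \<inter> X) \<and> card (M \<inter> X) \<le> l"

definition ca_sat_clause :: "'a set \<Rightarrow> 'a ca_clause \<Rightarrow> bool" where
  "ca_sat_clause M r \<longleftrightarrow> ((\<forall>B\<in>set (ca_bd r). ca_sat M B) \<longrightarrow> ca_sat M (ca_hd r))"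

definition ca_model :: "'a set \<Rightarrow> 'a ca_clause set \<Rightarrow> bool" where
  "ca_model M P \<longleftrightarrow> (\<forall>r\<in>P. ca_sat_clause M r)"


(* mc-atoms have finite sets; the type does not enforce this, but all mc-atoms in
   nss_reduct P M and e_mca P have finite sets whenever ca_program P holds.
   Bounds k > card X are allowed, and such MCAtom k X is satisfied by no set. *)
datatype 'a mcatom = MCAtom nat (aset: "'a set")

datatype 'a mcliteral = Pos "'a mcatom" | Neg "'a mcatom"

datatype 'a mca_rule = MCARule (hd_mca: "'a mcatom") (bd_mca: "'a mcliteral list")

(* MCARule is a clause with a head; mca_clause adds the headless ones. *)
datatype 'a mca_clause = Proper "'a mca_rule" | Constraint "'a mcliteral list"

fun mc_sat :: "'a set \<Rightarrow> 'a mcatom \<Rightarrow> bool" where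
  "mc_sat M (MCAtom k X) \<longleftrightarrow> k \<le> card (M \<inter> X)"

fun lit_sat :: "'a set \<Rightarrow> 'a mcliteral \<Rightarrow> bool" where
  "lit_sat M (Pos A) \<longleftrightarrow> mc_sat M A"
| "lit_sat M (Neg A) \<longleftrightarrow> \<not> mc_sat M A"

definition bd_sat :: "'a set \<Rightarrow> 'a mcliteral list \<Rightarrow> bool" where
  "bd_sat M Ls \<longleftrightarrow> (\<forall>L\<in>set Ls. lit_sat M L)"

definition constraint_sat :: "'a set \<Rightarrow> 'a mcliteral list \<Rightarrow> bool" where
  "constraint_sat M Ls \<longleftrightarrow> (\<exists>L\<in>set Ls. \<not> lit_sat M L)"

definition mca_model :: "'a set \<Rightarrow> 'a mca_rule set \<Rightarrow> bool" where
  "mca_model M Q \<longleftrightarrow> (\<forall>r\<in>Q. bd_sat M (bd_mca r) \<longrightarrow> mc_sat M (hd_mca r))"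

definition hset :: "'a mca_rule set \<Rightarrow> 'a set" where
  "hset Q = (\<Union>r\<in>Q. aset (hd_mca r))"

definition horn :: "'a mca_rule set \<Rightarrow> bool" where
  "horn Q \<longleftrightarrow> (\<forall>r\<in>Q. \<forall>A. Neg A \<notin> set (bd_mca r))"


fun lower :: "'a catom \<Rightarrow> 'a mcatom" where
  "lower (CAtom k X l) = MCAtom k X"

fun upper :: "'a catom \<Rightarrow> 'a mcatom" where
  "upper (CAtom k X l) = MCAtom (l + 1) X"

definition nss_reduct :: "'a ca_clause set \<Rightarrow> 'a set \<Rightarrow> 'a mca_rule set" where
  "nss_reduct P M =
    {MCARule (MCAtom 1 {a}) (map (Pos \<circ> lower) Bs) | k X l Bs a.
       CAClause (CAtom k X l) Bs \<in> P \<and> (\<forall>B\<in>set Bs. ca_sat M B) \<and> a \<in> X \<inter> M}"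

(* Least with respect to inclusion. Only meaningful when a least model exists;
   for the programs nss_reduct P M, see lm_nss_reduct_model and
   lm_nss_reduct_least below. *)
definition lm :: "'a mca_rule set \<Rightarrow> 'a set" where
  "lm Q = (LEAST N. mca_model N Q)"

definition ca_stable :: "'a set \<Rightarrow> 'a ca_clause set \<Rightarrow> bool" where
  "ca_stable M P \<longleftrightarrow> M = lm (nss_reduct P M) \<and> ca_model M P"


definition applicable :: "'a mca_rule set \<Rightarrow> 'a set \<Rightarrow> 'a mca_rule set" where
  "applicable Q M = {r \<in> Q. bd_sat M (bd_mca r)}"

definition T_nd :: "'a mca_rule set \<Rightarrow> 'a set \<Rightarrow> 'a set set" where
  "T_nd Q M = {M'. M' \<subseteq> hset (applicable Q M) \<and> (\<forall>r\<in>applicable Q M. mc_sat M' (hd_mca r))}"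

definition computation :: "'a mca_rule set \<Rightarrow> (nat \<Rightarrow> 'a set) \<Rightarrow> bool" where
  "computation Q X \<longleftrightarrow>
     X 0 = {} \<and> (\<forall>n. X n \<subseteq> X (Suc n)) \<and> (\<forall>n. X (Suc n) \<in> T_nd Q (X n))"

(* Used for Horn programs only; see horn_mca_reduct. *)
definition derivable_model :: "'a set \<Rightarrow> 'a mca_rule set \<Rightarrow> bool" where
  "derivable_model M Q \<longleftrightarrow> (\<exists>X. computation Q X \<and> M = (\<Union>n. X n))"

definition mca_reduct :: "'a mca_rule set \<Rightarrow> 'a set \<Rightarrow> 'a mca_rule set" where
  "mca_reduct Q M =
    {MCARule (hd_mca r) (filter (\<lambda>L. \<exists>A. L = Pos A) (bd_mca r)) | r.
       r \<in> Q \<and> \<not> (\<exists>A. Neg A \<in> set (bd_mca r) \<and> mc_sat M A)}"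

definition mca_rules_stable :: "'a set \<Rightarrow> 'a mca_rule set \<Rightarrow> bool" where
  "mca_rules_stable M Q \<longleftrightarrow> derivable_model M (mca_reduct Q M)"

definition mca_stable :: "'a set \<Rightarrow> 'a mca_clause set \<Rightarrow> bool" where
  "mca_stable M Q \<longleftrightarrow>
     mca_rules_stable M {r. Proper r \<in> Q} \<and> (\<forall>Ls. Constraint Ls \<in> Q \<longrightarrow> constraint_sat M Ls)"


definition body_tr :: "'a catom list \<Rightarrow> 'a mcliteral list" where
  "body_tr Bs = map (Pos \<circ> lower) Bs @ map (Neg \<circ> upper) Bs"

definition e1_mca :: "'a ca_clause \<Rightarrow> 'a mca_clause" where
  "e1_mca r = Proper (MCARule (lower (ca_hd r)) (body_tr (ca_bd r)))"

definition e2_mca :: "'a ca_clause \<Rightarrow> 'a mca_clause" where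
  "e2_mca r = Constraint (Pos (upper (ca_hd r)) # body_tr (ca_bd r))"

definition e_mca :: "'a ca_clause set \<Rightarrow> 'a mca_clause set" where
  "e_mca P = (\<Union>r\<in>P. {e1_mca r, e2_mca r})"


lemma mc_sat_singleton: "mc_sat N (MCAtom 1 {a}) \<longleftrightarrow> a \<in> N"
  by (cases "a \<in> N") auto

lemma horn_nss_reduct: "horn (nss_reduct P M)"
  by (auto simp: horn_def nss_reduct_def)

lemma horn_mca_reduct: "horn (mca_reduct Q M)"
  by (auto simp: horn_def mca_reduct_def)

lemma nss_reduct_model_iff:
  "mca_model N (nss_reduct P M) \<longleftrightarrow>
    (\<forall>k X l Bs a. CAClause (CAtom k X l) Bs \<in> P \<longrightarrow> (\<forall>B\<in>set Bs. ca_sat M B) \<longrightarrow> a \<in> X \<inter> M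
       \<longrightarrow> (\<forall>B\<in>set Bs. mc_sat N (lower B)) \<longrightarrow> a \<in> N)"
  unfolding mca_model_def nss_reduct_def bd_sat_def
  using mc_sat_singleton[of N] by (fastforce simp del: mc_sat.simps)

lemma mc_sat_lower_mono:
  assumes "wf_catom B" "N \<subseteq> N'" "mc_sat N (lower B)"
  shows "mc_sat N' (lower B)"
proof (cases B)
  case (CAtom k X l)
  then have "card (N \<inter> X) \<le> card (N' \<inter> X)"
    using assms by (intro card_mono) auto
  then show ?thesis
    using assms CAtom by simp
qed

lemma lm_nss_reduct:
  assumes "ca_program P"
  shows "lm (nss_reduct P M) = \<Inter>{N. mca_model N (nss_reduct P M)}"
    and "mca_model (\<Inter>{N. mca_model N (nss_reduct P M)}) (nss_reduct P M)"
proof -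
  let ?I = "\<Inter>{N. mca_model N (nss_reduct P M)}"
  show model: "mca_model ?I (nss_reduct P M)"
    unfolding nss_reduct_model_iff[of ?I]
  proof (intro allI impI)
    fix k X l Bs a
    assume r: "CAClause (CAtom k X l) Bs \<in> P" "\<forall>B\<in>set Bs. ca_sat M B" "a \<in> X \<inter> M"
      and sat: "\<forall>B\<in>set Bs. mc_sat ?I (lower B)"
    have "a \<in> N" if N: "mca_model N (nss_reduct P M)" for N
    proof -
      have "mc_sat N (lower B)" if B: "B \<in> set Bs" for B
      proof (rule mc_sat_lower_mono)
        show "wf_catom B"
          using assms r(1) B by (force simp: ca_program_def)
        show "?I \<subseteq> N"
          using N by blast
        show "mc_sat ?I (lower B)"
          using sat B by blast
      qed
      then show ?thesis
        using N r unfolding nss_reduct_model_iff by blast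
    qed
    then show "a \<in> ?I"
      by blast
  qed
  show "lm (nss_reduct P M) = ?I"
    unfolding lm_def by (rule Least_equality) (use model in blast)+
qed

lemma lm_nss_reduct_model:
  "ca_program P \<Longrightarrow> mca_model (lm (nss_reduct P M)) (nss_reduct P M)"
  using lm_nss_reduct by metis

lemma lm_nss_reduct_least:
  "ca_program P \<Longrightarrow> mca_model N (nss_reduct P M) \<Longrightarrow> lm (nss_reduct P M) \<subseteq> N"
  using lm_nss_reduct(1) by blast

end

(* Both reducts keep the lower-bound parts of the bodies. A clause survives the mca-reduct
   when M respects the upper bounds of its body, and the NSS-reduct when M satisfies its body
   outright. The two conditions differ only in the lower bounds, which hold in M as soon as
   they hold in some stage X_n of a computation inside M. Hence the stages of a computation
   of M and lm (P^M) derive the same atoms, and conversely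
   X_{n+1} = hset (Q(X_n)) Int M is a computation, because M |= P makes each
   applicable head true already in M. Chains of stages suffice since atom sets are finite. *)

theory Submission
  imports Defs
begin

section \<open>Satisfaction of bodies, and lower bounds along increasing chains\<close>

lemma ca_sat_iff: "ca_sat M B \<longleftrightarrow> mc_sat M (lower B) \<and> \<not> mc_sat M (upper B)"
  by (cases B) auto

lemma bd_sat_body_tr: "bd_sat M (body_tr Bs) \<longleftrightarrow> (\<forall>B\<in>set Bs. ca_sat M B)"
  by (auto simp: bd_sat_def body_tr_def ca_sat_iff ball_Un)

lemma bd_sat_map_Pos_lower:
  "bd_sat N (map (Pos \<circ> lower) Bs) \<longleftrightarrow> (\<forall>B\<in>set Bs. mc_sat N (lower B))"
  by (auto simp: bd_sat_def)

lemma ca_program_wf: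
  assumes "ca_program P" "CAClause H Bs \<in> P"
  shows "wf_catom H" and "B \<in> set Bs \<Longrightarrow> wf_catom B"
  using assms by (force simp: ca_program_def)+

text \<open>A compactness argument: \<open>B\<close> sees only finitely many atoms of the union,
  each of them has entered by some stage, and a common bound on these stages gives one member of the
  chain that agrees with the union on the set of \<open>B\<close>.\<close>

lemma mc_sat_lower_UN_chain:
  fixes X :: "nat \<Rightarrow> 'a set"
  assumes mono: "mono X" and wf: "wf_catom B" and sat: "mc_sat (\<Union>n. X n) (lower B)"
  shows "\<exists>n. mc_sat (X n) (lower B)"
proof (cases B)
  case (CAtom k Y l)
  have "finite ((\<Union>n. X n) \<inter> Y)"
    using wf CAtom by simp
  moreover have "\<forall>a\<in>(\<Union>n. X n) \<inter> Y. \<exists>n. a \<in> X n"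
    by blast
  then obtain f where f: "\<forall>a\<in>(\<Union>n. X n) \<inter> Y. a \<in> X (f a)"
    by metis
  ultimately have "finite (f ` ((\<Union>n. X n) \<inter> Y))"
    by blast
  then obtain n where n: "\<forall>a\<in>(\<Union>n. X n) \<inter> Y. f a \<le> n"
    by (auto simp: finite_nat_set_iff_bounded_le)
  have "(\<Union>n. X n) \<inter> Y = X n \<inter> Y"
    using f n monoD[OF mono] by blast
  then show ?thesis
    using sat CAtom by auto
qed

text \<open>Bodies are finite lists, and lower bounds persist along the chain, so the maximum of the
  stages for the single atoms works for all of them.\<close>

lemma mc_sat_lowers_UN_chain:
  fixes X :: "nat \<Rightarrow> 'a set"
  assumes mono: "mono X" and wf: "\<forall>B\<in>set Bs. wf_catom B"
    and sat: "\<forall>B\<in>set Bs. mc_sat (\<Union>n. X n) (lower B)"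
  shows "\<exists>n. \<forall>B\<in>set Bs. mc_sat (X n) (lower B)"
  using wf sat
proof (induction Bs)
  case Nil
  then show ?case by simp
next
  case (Cons B Bs)
  then obtain n where n: "\<forall>C\<in>set Bs. mc_sat (X n) (lower C)"
    by auto
  obtain m where m: "mc_sat (X m) (lower B)"
    using mc_sat_lower_UN_chain[OF mono, of B] Cons.prems by fastforce
  have "X n \<subseteq> X (max n m)" "X m \<subseteq> X (max n m)"
    by (rule monoD[OF mono], simp)+
  then have "\<forall>C\<in>set (B # Bs). mc_sat (X (max n m)) (lower C)"
    using n m Cons.prems(1) mc_sat_lower_mono by (metis set_ConsD)
  then show ?case by blast
qed

section \<open>The reduct and the constraints of the translated program\<close>

definition e1_reduct :: "'a ca_clause set \<Rightarrow> 'a set \<Rightarrow> 'a mca_rule set" where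
  "e1_reduct P M = {MCARule (lower H) (map (Pos \<circ> lower) Bs) | H Bs.
     CAClause H Bs \<in> P \<and> (\<forall>B\<in>set Bs. \<not> mc_sat M (upper B))}"

lemma proper_e_mca:
  "{r. Proper r \<in> e_mca P} =
    {MCARule (lower H) (body_tr Bs) | H Bs. CAClause H Bs \<in> P}"
proof (intro set_eqI iffI)
  fix r assume "r \<in> {r. Proper r \<in> e_mca P}"
  then obtain c where "c \<in> P" "r = MCARule (lower (ca_hd c)) (body_tr (ca_bd c))"
    by (auto simp: e_mca_def e1_mca_def e2_mca_def)
  then show "r \<in> {MCARule (lower H) (body_tr Bs) | H Bs. CAClause H Bs \<in> P}"
    by (cases c) auto
qed (force simp: e_mca_def e1_mca_def)

lemma filter_body_tr:
  "filter (\<lambda>L. \<exists>A. L = Pos A) (body_tr Bs) = map (Pos \<circ> lower) Bs"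
  by (induction Bs) (auto simp: body_tr_def filter_empty_conv)

text \<open>Every \<open>Neg\<close> literal of a translated body stems from an upper bound, so the
  blocked clauses are those with some \<open>upper B\<close> true in \<open>M\<close>; filtering
  then leaves just the lower bounds.\<close>

lemma mca_reduct_e_mca: "mca_reduct {r. Proper r \<in> e_mca P} M = e1_reduct P M"
proof -
  have neg: "(\<exists>A. Neg A \<in> set (body_tr Bs) \<and> mc_sat M A) \<longleftrightarrow>
      (\<exists>B\<in>set Bs. mc_sat M (upper B))" for Bs :: "'a catom list"
    by (auto simp: body_tr_def)
  \<comment> \<open>Fuses the two nested comprehensions, so that the reduct is indexed directly by
    the clauses of \<open>P\<close>.\<close>
  have push_image: "{f r | r. r \<in> {g H Bs | H Bs. A H Bs} \<and> R r} =
      {f (g H Bs) | H Bs. A H Bs \<and> R (g H Bs)}"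
    for f :: "'a mca_rule \<Rightarrow> 'a mca_rule" and g :: "'a catom \<Rightarrow> 'a catom list \<Rightarrow> 'a mca_rule"
      and A R
    by blast
  have "mca_reduct {r. Proper r \<in> e_mca P} M =
      {MCARule (lower H) (filter (\<lambda>L. \<exists>A. L = Pos A) (body_tr Bs)) | H Bs.
        CAClause H Bs \<in> P \<and> \<not> (\<exists>A. Neg A \<in> set (body_tr Bs) \<and> mc_sat M A)}"
    unfolding mca_reduct_def proper_e_mca push_image mca_rule.sel ..
  then show ?thesis
    unfolding neg filter_body_tr e1_reduct_def by simp
qed

text \<open>The constraints supply the half of \<open>ca_model\<close> that derivability cannot
  give: the upper bounds of heads.\<close>

lemma constraint_sat_e_mca:
  "(\<forall>Ls. Constraint Ls \<in> e_mca P \<longrightarrow> constraint_sat M Ls) \<longleftrightarrow>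
    (\<forall>H Bs. CAClause H Bs \<in> P \<longrightarrow> (\<forall>B\<in>set Bs. ca_sat M B) \<longrightarrow> \<not> mc_sat M (upper H))"
    (is "?L \<longleftrightarrow> ?R")
proof -
  have "?L \<longleftrightarrow> (\<forall>r\<in>P. constraint_sat M (Pos (upper (ca_hd r)) # body_tr (ca_bd r)))"
    by (auto simp: e_mca_def e1_mca_def e2_mca_def)
  also have "\<dots> \<longleftrightarrow>
      (\<forall>r\<in>P. (\<forall>B\<in>set (ca_bd r). ca_sat M B) \<longrightarrow> \<not> mc_sat M (upper (ca_hd r)))"
    unfolding bd_sat_body_tr[of M, symmetric]
    by (auto simp: constraint_sat_def bd_sat_def)
  also have "\<dots> \<longleftrightarrow> ?R"
    by (metis ca_clause.collapse ca_clause.sel)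
  finally show ?thesis .
qed

lemma mca_stable_e_mca:
  "mca_stable M (e_mca P) \<longleftrightarrow> derivable_model M (e1_reduct P M) \<and>
    (\<forall>H Bs. CAClause H Bs \<in> P \<longrightarrow> (\<forall>B\<in>set Bs. ca_sat M B) \<longrightarrow> \<not> mc_sat M (upper H))"
  by (simp add: mca_stable_def mca_rules_stable_def mca_reduct_e_mca constraint_sat_e_mca)

lemma ca_model_iff:
  "ca_model M P \<longleftrightarrow>
    (\<forall>H Bs. CAClause H Bs \<in> P \<longrightarrow> (\<forall>B\<in>set Bs. ca_sat M B) \<longrightarrow> ca_sat M H)"
  unfolding ca_model_def ca_sat_clause_def by (metis ca_clause.collapse ca_clause.sel)

lemma applicable_e1_reduct:
  "applicable (e1_reduct P M) N = {MCARule (lower H) (map (Pos \<circ> lower) Bs) | H Bs.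
     CAClause H Bs \<in> P \<and> (\<forall>B\<in>set Bs. \<not> mc_sat M (upper B) \<and> mc_sat N (lower B))}"
  unfolding applicable_def e1_reduct_def using bd_sat_map_Pos_lower[of N] by fastforce

lemma aset_lower: "aset (lower (CAtom k X l)) = X"
  by simp

lemma hset_applicable_e1_reduct:
  "a \<in> hset (applicable (e1_reduct P M) N) \<longleftrightarrow>
    (\<exists>k X l Bs. CAClause (CAtom k X l) Bs \<in> P \<and> a \<in> X \<and>
      (\<forall>B\<in>set Bs. \<not> mc_sat M (upper B) \<and> mc_sat N (lower B)))"
proof -
  have "a \<in> hset (applicable (e1_reduct P M) N) \<longleftrightarrow>
    (\<exists>H Bs. CAClause H Bs \<in> P \<and> a \<in> aset (lower H) \<and>
      (\<forall>B\<in>set Bs. \<not> mc_sat M (upper B) \<and> mc_sat N (lower B)))"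
    unfolding hset_def applicable_e1_reduct by fastforce
  then show ?thesis
    by (metis catom.exhaust aset_lower)
qed

text \<open>The upper bounds are already tested in \<open>M\<close>, and the lower bounds pass from
  \<open>N\<close> up to \<open>M\<close>. Hence a clause applicable at a stage inside
  \<open>M\<close> also survives the NSS-reduct.\<close>

lemma ca_sat_body_mono:
  assumes "ca_program P" "CAClause H Bs \<in> P" "N \<subseteq> M"
    and "\<forall>B\<in>set Bs. \<not> mc_sat M (upper B) \<and> mc_sat N (lower B)"
  shows "\<forall>B\<in>set Bs. ca_sat M B"
  using assms ca_program_wf(2)[OF assms(1,2)] mc_sat_lower_mono ca_sat_iff by metis

section \<open>From derivable models to the least model\<close>

lemma computation_mono: "computation Q X \<Longrightarrow> mono X"
  by (simp add: computation_def mono_iff_le_Suc)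

text \<open>By compactness the lower bounds of the body hold at some stage. The clause fires there,
  the next stage meets the lower bound of the head, and this bound persists in
  \<open>M\<close>.\<close>

lemma derivable_e1_reduct_imp_lower_head:
  assumes P: "ca_program P" and der: "derivable_model M (e1_reduct P M)"
    and r: "CAClause H Bs \<in> P" and body: "\<forall>B\<in>set Bs. ca_sat M B"
  shows "mc_sat M (lower H)"
proof -
  obtain X where X: "computation (e1_reduct P M) X" and M: "M = (\<Union>n. X n)"
    using der by (auto simp: derivable_model_def)
  obtain n where n: "\<forall>B\<in>set Bs. mc_sat (X n) (lower B)"
    using mc_sat_lowers_UN_chain[OF computation_mono[OF X]] ca_program_wf(2)[OF P r] body M
      ca_sat_iff by metis
  have "MCARule (lower H) (map (Pos \<circ> lower) Bs) \<in> applicable (e1_reduct P M) (X n)"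
    using r n body unfolding applicable_e1_reduct ca_sat_iff by blast
  moreover have "X (Suc n) \<in> T_nd (e1_reduct P M) (X n)"
    using X by (simp add: computation_def)
  ultimately have "mc_sat (X (Suc n)) (lower H)"
    unfolding T_nd_def by fastforce
  then show ?thesis
    using mc_sat_lower_mono[OF ca_program_wf(1)[OF P r]] M by blast
qed

lemma derivable_e1_reduct_imp_lm:
  assumes P: "ca_program P" and der: "derivable_model M (e1_reduct P M)"
  shows "M = lm (nss_reduct P M)"
proof
  obtain X where X: "computation (e1_reduct P M) X" and M: "M = (\<Union>n. X n)"
    using der by (auto simp: derivable_model_def)
  have "X n \<subseteq> lm (nss_reduct P M)" for n
  proof (induction n)
    case 0
    then show ?case
      using X by (simp add: computation_def)
  next
    case (Suc n)
    show ?case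
    proof
      fix a assume a: "a \<in> X (Suc n)"
      then have "a \<in> hset (applicable (e1_reduct P M) (X n))"
        using X by (auto simp: computation_def T_nd_def)
      then obtain k Y l Bs where r: "CAClause (CAtom k Y l) Bs \<in> P" "a \<in> Y"
        and body: "\<forall>B\<in>set Bs. \<not> mc_sat M (upper B) \<and> mc_sat (X n) (lower B)"
        unfolding hset_applicable_e1_reduct by blast
      have "\<forall>B\<in>set Bs. ca_sat M B"
        using ca_sat_body_mono[OF P r(1) _ body] M by blast
      moreover have "\<forall>B\<in>set Bs. mc_sat (lm (nss_reduct P M)) (lower B)"
        using body mc_sat_lower_mono[OF ca_program_wf(2)[OF P r(1)] Suc.IH] by blast
      \<comment> \<open>The NSS-reduct has a clause for \<open>a\<close> only if \<open>a\<close>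
        lies in \<open>M\<close>; here it does because the stage is part of
        \<open>M\<close>.\<close>
      moreover have "a \<in> Y \<inter> M"
        using a r(2) M by blast
      ultimately show "a \<in> lm (nss_reduct P M)"
        using lm_nss_reduct_model[OF P, of M] r(1) unfolding nss_reduct_model_iff by blast
    qed
  qed
  then show "M \<subseteq> lm (nss_reduct P M)"
    using M by blast
  \<comment> \<open>Immediate, since every head of this reduct is an atom of
    \<open>M\<close>.\<close>
  have "mca_model M (nss_reduct P M)"
    unfolding nss_reduct_model_iff by blast
  then show "lm (nss_reduct P M) \<subseteq> M"
    by (rule lm_nss_reduct_least[OF P])
qed

section \<open>A canonical computation inside a model of the program\<close>

primrec canonical_stage :: "'a ca_clause set \<Rightarrow> 'a set \<Rightarrow> nat \<Rightarrow> 'a set" where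
  "canonical_stage P M 0 = {}"
| "canonical_stage P M (Suc n) =
     hset (applicable (e1_reduct P M) (canonical_stage P M n)) \<inter> M"

lemma canonical_stage_subset: "canonical_stage P M n \<subseteq> M"
  by (cases n) auto

lemma hset_applicable_e1_reduct_mono:
  assumes "ca_program P" "N \<subseteq> N'"
  shows "hset (applicable (e1_reduct P M) N) \<subseteq> hset (applicable (e1_reduct P M) N')"
proof
  fix a assume "a \<in> hset (applicable (e1_reduct P M) N)"
  then show "a \<in> hset (applicable (e1_reduct P M) N')"
    unfolding hset_applicable_e1_reduct
    using mc_sat_lower_mono[OF ca_program_wf(2)[OF assms(1)] assms(2)] by meson
qed

text \<open>The choice in \<open>T_nd\<close> is resolved by adding every available head atom that
  lies in \<open>M\<close>. The next stage thus agrees with \<open>M\<close> on the set of each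
  applicable head, and that head is true in \<open>M\<close> because \<open>M\<close> is a model of
  \<open>P\<close>.\<close>

lemma computation_canonical_stage:
  assumes P: "ca_program P" and model: "ca_model M P"
  shows "computation (e1_reduct P M) (canonical_stage P M)"
  unfolding computation_def
proof (intro conjI allI)
  fix n
  let ?X = "canonical_stage P M"
  show "?X n \<subseteq> ?X (Suc n)"
  proof (induction n)
    case (Suc n)
    then show ?case
      using hset_applicable_e1_reduct_mono[OF P Suc.IH, of M] by auto
  qed simp
  have "mc_sat (?X (Suc n)) (hd_mca r)" if r: "r \<in> applicable (e1_reduct P M) (?X n)" for r
  proof -
    obtain H Bs where HBs: "CAClause H Bs \<in> P" "hd_mca r = lower H"
      and body: "\<forall>B\<in>set Bs. \<not> mc_sat M (upper B) \<and> mc_sat (?X n) (lower B)"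
      using r unfolding applicable_e1_reduct by auto
    have "\<forall>B\<in>set Bs. ca_sat M B"
      by (rule ca_sat_body_mono[OF P HBs(1) canonical_stage_subset body])
    then have head: "ca_sat M H"
      using model HBs(1) unfolding ca_model_iff by blast
    obtain k Y l where H: "H = CAtom k Y l"
      by (cases H)
    have "Y \<subseteq> hset (applicable (e1_reduct P M) (?X n))"
      using HBs(1) body unfolding H subset_iff hset_applicable_e1_reduct by blast
    then have "?X (Suc n) \<inter> Y = M \<inter> Y"
      by auto
    then show ?thesis
      using head HBs(2) H by (simp del: canonical_stage.simps)
  qed
  then show "?X (Suc n) \<in> T_nd (e1_reduct P M) (?X n)"
    by (simp add: T_nd_def)
qed simp

text \<open>The union of the canonical stages is closed under the NSS-reduct, so it contains the
  least model, which is \<open>M\<close>; it lies inside \<open>M\<close> by construction.\<close>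

lemma ca_stable_imp_derivable_e1_reduct:
  assumes P: "ca_program P" and stable: "ca_stable M P"
  shows "derivable_model M (e1_reduct P M)"
proof -
  let ?X = "canonical_stage P M"
  have comp: "computation (e1_reduct P M) ?X"
    using computation_canonical_stage[OF P] stable unfolding ca_stable_def by blast
  have "mca_model (\<Union>n. ?X n) (nss_reduct P M)"
    unfolding nss_reduct_model_iff
  proof (intro allI impI)
    fix k Y l Bs a
    assume r: "CAClause (CAtom k Y l) Bs \<in> P" and body: "\<forall>B\<in>set Bs. ca_sat M B"
      and a: "a \<in> Y \<inter> M" and "\<forall>B\<in>set Bs. mc_sat (\<Union>n. ?X n) (lower B)"
    then obtain n where "\<forall>B\<in>set Bs. mc_sat (?X n) (lower B)"
      using mc_sat_lowers_UN_chain[OF computation_mono[OF comp], of Bs] ca_program_wf(2)[OF P r]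
      by blast
    \<comment> \<open>The clause is applicable at stage \<open>n\<close>, as its upper bounds hold
      in \<open>M\<close>; since \<open>a\<close> is in \<open>M\<close>, the intersection with
      \<open>M\<close> keeps it.\<close>
    then have "a \<in> ?X (Suc n)"
      using r a body unfolding canonical_stage.simps Int_iff hset_applicable_e1_reduct ca_sat_iff
      by blast
    then show "a \<in> (\<Union>n. ?X n)"
      by blast
  qed
  then have least: "lm (nss_reduct P M) \<subseteq> (\<Union>n. ?X n)"
    by (rule lm_nss_reduct_least[OF P])
  have "M = lm (nss_reduct P M)"
    using stable unfolding ca_stable_def by (rule conjunct1)
  also note least
  finally have "M = (\<Union>n. ?X n)"
    by (rule subset_antisym) (simp add: UN_least canonical_stage_subset)
  then show ?thesis
    using comp unfolding derivable_model_def by blast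
qed

theorem theorem5:
  fixes P :: "'a ca_clause set" and M :: "'a set"
  assumes "ca_program P"
  shows "ca_stable M P \<longleftrightarrow> mca_stable M (e_mca P)"
proof
  assume stable: "ca_stable M P"
  then have "ca_model M P"
    by (simp add: ca_stable_def)
  then show "mca_stable M (e_mca P)"
    using ca_stable_imp_derivable_e1_reduct[OF assms stable]
    unfolding mca_stable_e_mca ca_model_iff ca_sat_iff[of M] by blast
next
  assume "mca_stable M (e_mca P)"
  then have der: "derivable_model M (e1_reduct P M)"
    and "\<forall>H Bs. CAClause H Bs \<in> P \<longrightarrow> (\<forall>B\<in>set Bs. ca_sat M B) \<longrightarrow> \<not> mc_sat M (upper H)"
    unfolding mca_stable_e_mca by blast+
  \<comment> \<open>The lower bounds of heads come from derivability, the upper ones from the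
    constraints.\<close>
  then have "ca_model M P"
    unfolding ca_model_iff
    using derivable_e1_reduct_imp_lower_head[OF assms der] ca_sat_iff by blast
  then show "ca_stable M P"
    using derivable_e1_reduct_imp_lm[OF assms der] by (simp add: ca_stable_def)
qed

end
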